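(* Let $\mathcal{A}\in\mathbb{R}^{n\times n\times p}$ be T-SPD, $d=np$, with largest T-eigenvalue $\lambda_1(\mathcal{A})$. Let $\hat\lambda_1^{\rm pow}$ be the Rayleigh quotient produced by the T-product randomized power method after $q\ge 1$ iterations, and let $\hat\lambda_1^{\rm TDep}:=m+s\sqrt{d-1}$. Then, almost surely over the random initialisation, $$\hat\lambda_1^{\rm pow}\;\le\;\lambda_1(\mathcal{A})\;\le\;\hat\lambda_1^{\rm TDep}.$$ Consequently, the interval $[\hat\lambda_1^{\rm pow},\hat\lambda_1^{\rm TDep}]$ contains the largest T-eigenvalue of $\mathcal{A}$.
   Context: For $\mathcal{A}\in\mathbb{R}^{n\times n\times p}$ with frontal slices $\mathcal{A}^{(1)},\dots,\mathcal{A}^{(p)}\in\mathbb{R}^{n\times n}$, $\operatorname{bcirc}(\mathcal{A})\in\mathbb{R}^{np\times np}$ is the block circulant matrix whose $(i,j)$ block ($1\le i,j\le p$) is $\mathcal{A}^{(((i-j)\bmod p)+1)}$. The tensor $\mathcal{A}$ is T-SPD if $\operatorname{bcirc}(\mathcal{A})$ is symmetric positive definite. The T-eigenvalues of $\mathcal{A}$ are the eigenvalues $\lambda_1\ge\dots\ge\lambda_d>0$ of $\operatorname{bcirc}(\mathcal{A})$, counted with multiplicity, $d=np$. The mean and standard deviation of the spectrum are $$m=\frac{\operatorname{tr}(\operatorname{bcirc}(\mathcal{A}))}{d}=\frac1d\sum_{i=1}^d\lambda_i,\qquad s=\sqrt{\frac{\operatorname{tr}(\operatorname{bcirc}(\mathcal{A})^2)}{d}-m^2}=\sqrt{\frac1d\sum_{i=1}^d\lambda_i^2-m^2}\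 \ge 0 .$$ T-product randomized power method with $q$ iterations: draw $\mathbf{x}_0\sim\mathcal{N}(0,I_d)$ and normalize it to unit Euclidean norm; for $k=1,\dots,q$ set $\mathbf{y}_k=\operatorname{bcirc}(\mathcal{A})\mathbf{x}_{k-1}$ and $\mathbf{x}_k=\mathbf{y}_k/\|\mathbf{y}_k\|_2$; output $\hat\lambda_1^{\rm pow}=\mathbf{x}_q^{\mathsf T}\operatorname{bcirc}(\mathcal{A})\mathbf{x}_q$. *)

theory Defs
  imports
    "Jordan_Normal_Form.Char_Poly"
    "HOL-Probability.Probability"
begin

(* '$' and the bullet stand for the operations of Jordan_Normal_Form.Matrix below. *)
unbundle no vec_syntax
unbundle no inner_syntax

(* A real n x n x p tensor is the list of its p frontal slices, so that the slice with 1-based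
   index k + 1 is A ! k. *)
definition tensors :: "nat \<Rightarrow> nat \<Rightarrow> real Matrix.mat list set" where
  "tensors n p = {A. length A = p \<and> set A \<subseteq> carrier_mat n n}"

(* Entry (r, c) lies in block (r div n, c div n), at position (r mod n, c mod n) of it.
   The mod is taken on int, so that it is the nonnegative residue also when the block row
   is smaller than the block column. *)
definition bcirc :: "nat \<Rightarrow> nat \<Rightarrow> real Matrix.mat list \<Rightarrow> real Matrix.mat" where
  "bcirc n p A = Matrix.mat (n * p) (n * p)
     (\<lambda>(r, c). (A ! nat ((int (r div n) - int (c div n)) mod int p)) $$ (r mod n, c mod n))"

definition sym_pos_def :: "real Matrix.mat \<Rightarrow> bool" where
  "sym_pos_def B \<longleftrightarrow> square_mat B \<and> transpose_mat B = B \<and>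
     (\<forall>v \<in> carrier_vec (dim_row B). v \<noteq> 0\<^sub>v (dim_row B) \<longrightarrow> v \<bullet> (B *\<^sub>v v) > 0)"

definition T_SPD :: "nat \<Rightarrow> nat \<Rightarrow> real Matrix.mat list \<Rightarrow> bool" where
  "T_SPD n p A \<longleftrightarrow> sym_pos_def (bcirc n p A)"

(* The real eigenvalues, repeated according to algebraic multiplicity, in nonincreasing order. *)
definition T_eigenvalues :: "nat \<Rightarrow> nat \<Rightarrow> real Matrix.mat list \<Rightarrow> real list" where
  "T_eigenvalues n p A = rev (sorted_list_of_multiset (proots (char_poly (bcirc n p A))))"

definition largest_T_eigenvalue :: "nat \<Rightarrow> nat \<Rightarrow> real Matrix.mat list \<Rightarrow> real" where
  "largest_T_eigenvalue n p A = hd (T_eigenvalues n p A)"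

definition mat_trace :: "real Matrix.mat \<Rightarrow> real" where
  "mat_trace B = (\<Sum>i < dim_row B. B $$ (i, i))"

definition spec_mean :: "nat \<Rightarrow> nat \<Rightarrow> real Matrix.mat list \<Rightarrow> real" where
  "spec_mean n p A = mat_trace (bcirc n p A) / real (n * p)"

definition spec_std :: "nat \<Rightarrow> nat \<Rightarrow> real Matrix.mat list \<Rightarrow> real" where
  "spec_std n p A =
     sqrt (mat_trace (bcirc n p A ^\<^sub>m 2) / real (n * p) - (spec_mean n p A)\<^sup>2)"

definition TDep_estimate :: "nat \<Rightarrow> nat \<Rightarrow> real Matrix.mat list \<Rightarrow> real" where
  "TDep_estimate n p A = spec_mean n p A + spec_std n p A * sqrt (real (n * p) - 1)"

definition vec_norm2 :: "real Matrix.vec \<Rightarrow> real" where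
  "vec_norm2 v = sqrt (v \<bullet> v)"

(* The zero vector is sent to itself, since 1 / 0 = 0; a Gaussian start is almost surely
   nonzero. *)
definition unit_vec_of :: "real Matrix.vec \<Rightarrow> real Matrix.vec" where
  "unit_vec_of v = (1 / vec_norm2 v) \<cdot>\<^sub>v v"

(* The first argument is the matrix, the second the draw before normalization. *)
primrec power_iterate :: "real Matrix.mat \<Rightarrow> real Matrix.vec \<Rightarrow> nat \<Rightarrow> real Matrix.vec" where
  "power_iterate B g 0 = unit_vec_of g"
| "power_iterate B g (Suc k) = unit_vec_of (B *\<^sub>v power_iterate B g k)"

definition pow_estimate ::
  "nat \<Rightarrow> nat \<Rightarrow> real Matrix.mat list \<Rightarrow> nat \<Rightarrow> real Matrix.vec \<Rightarrow> real" where
  "pow_estimate n p A q g =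
     (let x = power_iterate (bcirc n p A) g q in x \<bullet> (bcirc n p A *\<^sub>v x))"

(* Law N(0, I_d): independent standard normal coordinates. *)
definition std_gaussian_vec ::
  "'w measure \<Rightarrow> nat \<Rightarrow> ('w \<Rightarrow> real Matrix.vec) \<Rightarrow> bool" where
  "std_gaussian_vec M d g \<longleftrightarrow>
     (\<forall>\<omega> \<in> space M. g \<omega> \<in> carrier_vec d) \<and>
     prob_space.indep_vars M (\<lambda>_. borel) (\<lambda>i \<omega>. g \<omega> $ i) {..<d} \<and>
     (\<forall>i < d. distributed M lborel (\<lambda>\<omega>. g \<omega> $ i) (\<lambda>x. ennreal (std_normal_density x)))"

lemma bcirc_carrier: "bcirc n p A \<in> carrier_mat (n * p) (n * p)"
  by (simp add: bcirc_def)

lemma sorted_T_eigenvalues: "sorted_wrt (\<ge>) (T_eigenvalues n p A)"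
  by (simp add: T_eigenvalues_def sorted_wrt_rev)

lemma set_T_eigenvalues: "set (T_eigenvalues n p A) = {l. eigenvalue (bcirc n p A) l}"
proof -
  have "char_poly (bcirc n p A) \<noteq> 0"
    using degree_monic_char_poly[OF bcirc_carrier, of n p A] by auto
  then show ?thesis
    by (simp add: T_eigenvalues_def eigenvalue_root_char_poly[OF bcirc_carrier])
qed

end

theory Submission
  imports Defs
begin

text \<open>The Rayleigh quotient of a symmetric matrix \<open>B\<close> is bounded by its supremum \<open>\<mu>\<close>, and \<open>\<mu>\<close> is
  an eigenvalue: otherwise \<open>\<mu> I - B\<close> is positive semidefinite and nonsingular, hence bounded below
  by some \<open>\<epsilon> > 0\<close>, and \<open>\<mu> - \<epsilon>\<close> is a smaller bound. So the lower estimate holds for every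
  draw of the starting vector. For the upper estimate, let \<open>v\<close> be a unit eigenvector for the
  eigenvalue \<open>l\<close>. The Frobenius inner product of \<open>B - m I\<close> and \<open>v v\<^sup>T - I / d\<close> is \<open>l - m\<close>, and the
  squares of their norms are \<open>d s\<^sup>2\<close> and \<open>1 - 1 / d\<close>; Cauchy--Schwarz gives
  \<open>(l - m)\<^sup>2 \<le> (d - 1) s\<^sup>2\<close>.\<close>

section \<open>Scalar products and quadratic forms in coordinates\<close>

lemma scalar_prod_self_eq_sum:
  fixes x :: "real Matrix.vec"
  assumes "x \<in> carrier_vec d"
  shows "x \<bullet> x = (\<Sum>i<d. (x $ i)\<^sup>2)"
  using assms by (auto simp: scalar_prod_def power2_eq_square lessThan_atLeast0)

lemma scalar_prod_self_nonneg: "(x :: real Matrix.vec) \<bullet> x \<ge> 0"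
  by (auto simp: scalar_prod_def intro: sum_nonneg)

lemma scalar_prod_self_pos:
  fixes x :: "real Matrix.vec"
  assumes "x \<in> carrier_vec d" "x \<noteq> 0\<^sub>v d"
  shows "x \<bullet> x > 0"
proof -
  obtain i where i: "i < d" "x $ i \<noteq> 0"
    using assms by (metis carrier_vecD eq_vecI index_zero_vec)
  have "0 < (\<Sum>i<d. (x $ i)\<^sup>2)"
    using i by (intro sum_pos2[of _ i]) auto
  then show ?thesis using scalar_prod_self_eq_sum[OF assms(1)] by simp
qed

lemma bilinear_form_eq_sum:
  fixes D :: "real Matrix.mat"
  assumes "D \<in> carrier_mat d d" "x \<in> carrier_vec d" "y \<in> carrier_vec d"
  shows "x \<bullet> (D *\<^sub>v y) = (\<Sum>i<d. \<Sum>j<d. x $ i * D $$ (i, j) * y $ j)"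
  using assms by (auto simp: scalar_prod_def lessThan_atLeast0 sum_distrib_left mult.assoc
      intro!: sum.cong)

lemma scalar_mat_mult_vec:
  fixes k :: "'a :: comm_ring_1"
  assumes "v \<in> carrier_vec d"
  shows "(k \<cdot>\<^sub>m 1\<^sub>m d) *\<^sub>v v = k \<cdot>\<^sub>v v"
  using assms
  by (intro eq_vecI) (auto simp: scalar_prod_def if_distrib if_distribR mult_delta_left cong: if_cong)

text \<open>Each product of two coordinates is at most \<open>x \<bullet> x\<close> in absolute
  value, by the inequality of arithmetic and geometric means. The crude constant suffices both to
  make the supremum of the Rayleigh quotients finite and to control the adjugate in the coercivity
  estimate.\<close>

lemma quadratic_form_bounded:
  fixes D :: "real Matrix.mat"
  assumes D: "D \<in> carrier_mat d d" and x: "x \<in> carrier_vec d"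
  shows "\<bar>x \<bullet> (D *\<^sub>v x)\<bar> \<le> (\<Sum>i<d. \<Sum>j<d. \<bar>D $$ (i, j)\<bar>) * (x \<bullet> x)"
proof -
  have sq: "(x $ i)\<^sup>2 \<le> x \<bullet> x" if "i < d" for i
    unfolding scalar_prod_self_eq_sum[OF x] using that by (intro member_le_sum) auto
  have prod: "\<bar>x $ i\<bar> * \<bar>x $ j\<bar> \<le> x \<bullet> x" if "i < d" "j < d" for i j
  proof -
    have "2 * (\<bar>x $ i\<bar> * \<bar>x $ j\<bar>) \<le> (x $ i)\<^sup>2 + (x $ j)\<^sup>2"
      using sum_squares_bound[of "\<bar>x $ i\<bar>" "\<bar>x $ j\<bar>"] by simp
    then show ?thesis using sq[OF that(1)] sq[OF that(2)] by linarith
  qed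
  have "\<bar>x \<bullet> (D *\<^sub>v x)\<bar> \<le> (\<Sum>i<d. \<Sum>j<d. \<bar>x $ i * D $$ (i, j) * x $ j\<bar>)"
    unfolding bilinear_form_eq_sum[OF D x x]
    by (intro order_trans[OF sum_abs] sum_mono sum_abs)
  also have "\<dots> \<le> (\<Sum>i<d. \<Sum>j<d. \<bar>D $$ (i, j)\<bar> * (x \<bullet> x))"
  proof (intro sum_mono)
    fix i j assume "i \<in> {..<d}" "j \<in> {..<d}"
    then have "\<bar>D $$ (i, j)\<bar> * (\<bar>x $ i\<bar> * \<bar>x $ j\<bar>) \<le> \<bar>D $$ (i, j)\<bar> * (x \<bullet> x)"
      using prod by (intro mult_left_mono) auto
    then show "\<bar>x $ i * D $$ (i, j) * x $ j\<bar> \<le> \<bar>D $$ (i, j)\<bar> * (x \<bullet> x)"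
      by (simp add: abs_mult mult_ac)
  qed
  finally show ?thesis by (simp add: sum_distrib_right)
qed

section \<open>Cauchy--Schwarz and coercivity for semidefinite forms\<close>

text \<open>For positive \<open>c\<close>, evaluating at the minimizer \<open>- b / c\<close> gives
  the claim. A vanishing \<open>c\<close> leaves an affine function, which must be constant, and a
  negative \<open>c\<close> is excluded by the behaviour for large \<open>t\<close>.\<close>

lemma nonneg_quadratic_discriminant:
  fixes a b c :: real
  assumes nonneg: "\<And>t. a + 2 * t * b + t\<^sup>2 * c \<ge> 0"
  shows "b\<^sup>2 \<le> a * c"
proof (cases "c = 0")
  case True
  have "b = 0"
  proof (rule ccontr)
    assume "b \<noteq> 0"
    \<comment> \<open>The argument is chosen so that the affine function
      \<open>a + 2 * t * b\<close> takes the value -1.\<close>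
    then have "2 * (- (a + 1) / (2 * b)) * b = - a - 1" by simp
    then show False using nonneg[of "- (a + 1) / (2 * b)"] True by simp
  qed
  then show ?thesis using True by simp
next
  case False
  have "c > 0"
  proof (rule ccontr)
    assume "\<not> c > 0"
    then have "c < 0" using False by simp
    \<comment> \<open>With this choice \<open>t\<^sup>2 * c\<close> equals
      \<open>- t * \<bar>a\<bar> - 2 * t * \<bar>b\<bar> + t * c\<close>. The first two summands
      absorb \<open>a\<close> and \<open>2 * t * b\<close>, the former because
      \<open>t \<ge> 1\<close>, and the negative \<open>t * c\<close> remains.\<close>
    define t where "t = \<bar>a\<bar> / - c + 2 * \<bar>b\<bar> / - c + 1"
    have t: "t \<ge> 1" "t * - c = \<bar>a\<bar> + 2 * \<bar>b\<bar> - c"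
      using \<open>c < 0\<close> by (auto simp: t_def field_simps)
    have "t * (t * - c) = t * \<bar>a\<bar> + 2 * t * \<bar>b\<bar> - t * c"
      unfolding t(2) by (simp add: algebra_simps)
    moreover have "t * \<bar>a\<bar> \<ge> a" using t mult_right_mono[of 1 t "\<bar>a\<bar>"] by simp
    moreover have "t * \<bar>b\<bar> \<ge> t * b" using t by (intro mult_left_mono) auto
    moreover have "t * c < 0" using t \<open>c < 0\<close> by (simp add: mult_pos_neg)
    ultimately have "a + 2 * t * b + t\<^sup>2 * c < 0" by (simp add: power2_eq_square mult.assoc)
    then show False using nonneg[of t] by linarith
  qed
  have "a + 2 * (- b / c) * b + (- b / c)\<^sup>2 * c = a - b\<^sup>2 / c"
    using \<open>c > 0\<close> by (simp add: power2_eq_square field_simps)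
  then have "b\<^sup>2 / c \<le> a" using nonneg[of "- b / c"] by simp
  then show ?thesis using \<open>c > 0\<close> by (simp add: field_simps)
qed

text \<open>The form evaluated at \<open>x + t \<cdot>\<^sub>v y\<close> is a nonnegative quadratic
  polynomial in \<open>t\<close>; symmetry of \<open>C\<close> merges its two mixed terms.\<close>

lemma psd_form_Cauchy_Schwarz:
  fixes C :: "real Matrix.mat"
  assumes C: "C \<in> carrier_mat d d" and sym: "transpose_mat C = C"
    and psd: "\<And>v. v \<in> carrier_vec d \<Longrightarrow> v \<bullet> (C *\<^sub>v v) \<ge> 0"
    and x: "x \<in> carrier_vec d" and y: "y \<in> carrier_vec d"
  shows "(x \<bullet> (C *\<^sub>v y))\<^sup>2 \<le> (x \<bullet> (C *\<^sub>v x)) * (y \<bullet> (C *\<^sub>v y))"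
proof (rule nonneg_quadratic_discriminant)
  fix t :: real
  have Cx: "C *\<^sub>v x \<in> carrier_vec d" and Cy: "C *\<^sub>v y \<in> carrier_vec d"
    using C x y by auto
  have flip: "y \<bullet> (C *\<^sub>v x) = x \<bullet> (C *\<^sub>v y)"
    using transpose_vec_mult_scalar[OF C x y] sym comm_scalar_prod[OF Cy x] by simp
  have "(x + t \<cdot>\<^sub>v y) \<bullet> (C *\<^sub>v (x + t \<cdot>\<^sub>v y))
      = (x + t \<cdot>\<^sub>v y) \<bullet> (C *\<^sub>v x + t \<cdot>\<^sub>v (C *\<^sub>v y))"
    using C x y by (simp add: mult_add_distrib_mat_vec[of _ d d] mult_mat_vec[of _ d d])
  also have "\<dots> = x \<bullet> (C *\<^sub>v x) + 2 * t * (x \<bullet> (C *\<^sub>v y)) + t\<^sup>2 * (y \<bullet> (C *\<^sub>v y))"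
    using x y Cx Cy
    by (simp add: add_scalar_prod_distrib[of _ d] scalar_prod_add_distrib[of _ d] flip
        power2_eq_square algebra_simps)
  finally show "0 \<le> x \<bullet> (C *\<^sub>v x) + 2 * t * (x \<bullet> (C *\<^sub>v y)) + t\<^sup>2 * (y \<bullet> (C *\<^sub>v y))"
    using psd[of "x + t \<cdot>\<^sub>v y"] x y by simp
qed

text \<open>The adjugate serves as determinant times inverse:
  \<open>y = adj_mat C *\<^sub>v x\<close> satisfies
  \<open>C *\<^sub>v y = Determinant.det C \<cdot>\<^sub>v x\<close>. Cauchy--Schwarz for the form
  of \<open>C\<close> then bounds the square of \<open>Determinant.det C * (x \<bullet> x)\<close>
  by the form at \<open>x\<close> times the form at \<open>y\<close>, and the latter is at most a
  constant times \<open>x \<bullet> x\<close>.\<close>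

lemma psd_nonsingular_coercive:
  fixes C :: "real Matrix.mat"
  assumes C: "C \<in> carrier_mat d d" and sym: "transpose_mat C = C"
    and psd: "\<And>v. v \<in> carrier_vec d \<Longrightarrow> v \<bullet> (C *\<^sub>v v) \<ge> 0"
    and det: "Determinant.det C \<noteq> 0"
  obtains e where "e > 0" "\<And>x. x \<in> carrier_vec d \<Longrightarrow> e * (x \<bullet> x) \<le> x \<bullet> (C *\<^sub>v x)"
proof -
  define D where "D = adj_mat C"
  have D: "D \<in> carrier_mat d d" "C * D = Determinant.det C \<cdot>\<^sub>m 1\<^sub>m d"
    using adj_mat[OF C] by (auto simp: D_def)
  \<comment> \<open>Adding 1 makes \<open>K\<close> a positive divisor without a check that the
    adjugate has a nonzero entry.\<close>
  define K where "K = (\<Sum>i<d. \<Sum>j<d. \<bar>D $$ (i, j)\<bar>) + 1"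
  have K: "K > 0" by (auto simp: K_def intro!: add_nonneg_pos sum_nonneg)
  have "\<bar>Determinant.det C\<bar> / K * (x \<bullet> x) \<le> x \<bullet> (C *\<^sub>v x)" if x: "x \<in> carrier_vec d" for x
  proof (cases "x = 0\<^sub>v d")
    case True
    then show ?thesis using psd[OF x] by simp
  next
    case False
    define r where "r = x \<bullet> x"
    have r: "r > 0" using scalar_prod_self_pos[OF x False] by (simp add: r_def)
    define y where "y = D *\<^sub>v x"
    have y: "y \<in> carrier_vec d" using D x by (simp add: y_def)
    have "C *\<^sub>v y = (C * D) *\<^sub>v x" unfolding y_def by (rule assoc_mult_mat_vec[OF C D(1) x, symmetric])
    also have "\<dots> = Determinant.det C \<cdot>\<^sub>v x"
      using x by (simp add: D(2) scalar_mat_mult_vec)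
    finally have Cy: "C *\<^sub>v y = Determinant.det C \<cdot>\<^sub>v x" .
    have "\<bar>y \<bullet> x\<bar> = \<bar>x \<bullet> (D *\<^sub>v x)\<bar>"
      using comm_scalar_prod[OF x y] by (simp add: y_def)
    also have "\<dots> \<le> (K - 1) * r"
      using quadratic_form_bounded[OF D(1) x] by (simp add: K_def r_def)
    also have "\<dots> \<le> K * r" using r by (simp add: algebra_simps)
    finally have yx: "\<bar>y \<bullet> x\<bar> \<le> K * r" .
    have "(\<bar>Determinant.det C\<bar> * r)\<^sup>2 = (x \<bullet> (C *\<^sub>v y))\<^sup>2"
      using x by (simp add: Cy r_def power_mult_distrib)
    also have "\<dots> \<le> (x \<bullet> (C *\<^sub>v x)) * (y \<bullet> (C *\<^sub>v y))"
      by (rule psd_form_Cauchy_Schwarz[OF C sym psd x y])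
    also have "\<dots> \<le> (x \<bullet> (C *\<^sub>v x)) * (\<bar>Determinant.det C\<bar> * (K * r))"
    proof (rule mult_left_mono[OF _ psd[OF x]])
      have "y \<bullet> (C *\<^sub>v y) = Determinant.det C * (y \<bullet> x)" using x y by (simp add: Cy)
      also have "\<dots> \<le> \<bar>Determinant.det C\<bar> * \<bar>y \<bullet> x\<bar>" by (metis abs_ge_self abs_mult)
      also have "\<dots> \<le> \<bar>Determinant.det C\<bar> * (K * r)" by (rule mult_left_mono[OF yx]) simp
      finally show "y \<bullet> (C *\<^sub>v y) \<le> \<bar>Determinant.det C\<bar> * (K * r)" .
    qed
    finally have "(\<bar>Determinant.det C\<bar> * r) * (\<bar>Determinant.det C\<bar> * r) \<le> (K * (x \<bullet> (C *\<^sub>v x))) * (\<bar>Determinant.det C\<bar> * r)"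
      by (simp add: power2_eq_square mult_ac)
    \<comment> \<open>Cancelling the common positive factor produces the coercivity constant
      \<open>\<bar>Determinant.det C\<bar> / K\<close>.\<close>
    then have "\<bar>Determinant.det C\<bar> * r \<le> K * (x \<bullet> (C *\<^sub>v x))"
      by (rule mult_right_le_imp_le) (use det r in simp)
    then show ?thesis using K by (simp add: r_def field_simps)
  qed
  moreover have "\<bar>Determinant.det C\<bar> / K > 0" using det K by simp
  ultimately show ?thesis using that by blast
qed

section \<open>The supremum of the Rayleigh quotient as an eigenvalue\<close>

text \<open>Besides the bound, this provides the existence of a real eigenvalue, so that the list of
  T-eigenvalues is nonempty and its head is meaningful.\<close>

lemma rayleigh_bounded_by_eigenvalue:
  fixes B :: "real Matrix.mat"
  assumes B: "B \<in> carrier_mat d d" and sym: "transpose_mat B = B" and d: "d \<ge> 1"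
  obtains \<mu> where "eigenvalue B \<mu>" "\<And>x. x \<in> carrier_vec d \<Longrightarrow> x \<bullet> (B *\<^sub>v x) \<le> \<mu> * (x \<bullet> x)"
proof -
  define S where "S = {x \<bullet> (B *\<^sub>v x) | x. x \<in> carrier_vec d \<and> x \<bullet> x = 1}"
  have "unit_vec d 0 \<bullet> (unit_vec d 0 :: real Matrix.vec) = 1"
    using d by simp
  then have ne: "S \<noteq> {}" unfolding S_def using unit_vec_carrier by blast
  have bdd: "bdd_above S"
  proof (rule bdd_aboveI)
    fix s assume "s \<in> S"
    then obtain x where "x \<in> carrier_vec d" "x \<bullet> x = 1" "s = x \<bullet> (B *\<^sub>v x)"
      by (auto simp: S_def)
    then show "s \<le> (\<Sum>i<d. \<Sum>j<d. \<bar>B $$ (i, j)\<bar>)"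
      using quadratic_form_bounded[OF B, of x] by simp
  qed
  define \<mu> where "\<mu> = Sup S"
  have bound: "x \<bullet> (B *\<^sub>v x) \<le> \<mu> * (x \<bullet> x)" if x: "x \<in> carrier_vec d" for x
  proof (cases "x = 0\<^sub>v d")
    case True
    then show ?thesis using B by (simp add: x)
  next
    case False
    define r where "r = sqrt (x \<bullet> x)"
    have r: "r > 0" "r * r = x \<bullet> x"
      using scalar_prod_self_pos[OF x False] by (auto simp: r_def)
    define u where "u = (1 / r) \<cdot>\<^sub>v x"
    have u: "u \<in> carrier_vec d" using x by (simp add: u_def)
    have "u \<bullet> u = (x \<bullet> x) / (r * r)" using x by (simp add: u_def)
    then have "u \<bullet> u = 1" using r by (metis divide_self less_irrefl mult_eq_0_iff)
    then have "u \<bullet> (B *\<^sub>v u) \<le> \<mu>"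
      unfolding \<mu>_def using u bdd by (intro cSup_upper) (auto simp: S_def)
    moreover have "u \<bullet> (B *\<^sub>v u) = (x \<bullet> (B *\<^sub>v x)) / (r * r)"
      using x B by (simp add: u_def mult_mat_vec[of _ d d])
    ultimately have "(x \<bullet> (B *\<^sub>v x)) / (x \<bullet> x) \<le> \<mu>" using r(2) by simp
    then show ?thesis using scalar_prod_self_pos[OF x False] by (simp add: pos_divide_le_eq)
  qed
  define C where "C = \<mu> \<cdot>\<^sub>m 1\<^sub>m d - B"
  have C: "C \<in> carrier_mat d d" using B by (simp add: C_def minus_carrier_mat)
  have Cv: "C *\<^sub>v v = \<mu> \<cdot>\<^sub>v v - B *\<^sub>v v" if "v \<in> carrier_vec d" for v
    using B that
    by (simp add: C_def minus_mult_distrib_mat_vec[of _ d d] scalar_mat_mult_vec)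
  have form: "v \<bullet> (C *\<^sub>v v) = \<mu> * (v \<bullet> v) - v \<bullet> (B *\<^sub>v v)" if "v \<in> carrier_vec d" for v
    using that B by (simp add: Cv scalar_prod_minus_distrib[of _ d])
  have symC: "transpose_mat C = C"
  proof -
    have "transpose_mat (\<mu> \<cdot>\<^sub>m 1\<^sub>m d) = \<mu> \<cdot>\<^sub>m 1\<^sub>m d"
      by (rule eq_matI) auto
    then show ?thesis using B sym by (simp add: C_def transpose_minus[of _ d d])
  qed
  have "Determinant.det C = 0"
  proof (rule ccontr)
    assume "Determinant.det C \<noteq> 0"
    then obtain e where e: "e > 0" "\<And>x. x \<in> carrier_vec d \<Longrightarrow> e * (x \<bullet> x) \<le> x \<bullet> (C *\<^sub>v x)"
      using psd_nonsingular_coercive[OF C symC] form bound by (metis diff_ge_0_iff_ge)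
    have "Sup S \<le> \<mu> - e"
    proof (rule cSup_least[OF ne])
      fix s assume "s \<in> S"
      then obtain x where "x \<in> carrier_vec d" "x \<bullet> x = 1" "s = x \<bullet> (B *\<^sub>v x)"
        by (auto simp: S_def)
      then show "s \<le> \<mu> - e" using e(2)[of x] form[of x] by simp
    qed
    then show False using e(1) by (simp add: \<mu>_def)
  qed
  then obtain v where v: "v \<in> carrier_vec d" "v \<noteq> 0\<^sub>v d" "C *\<^sub>v v = 0\<^sub>v d"
    using det_0_iff_vec_prod_zero[OF C] by blast
  have "B *\<^sub>v v = \<mu> \<cdot>\<^sub>v v"
  proof (rule eq_vecI)
    fix i assume "i < dim_vec (\<mu> \<cdot>\<^sub>v v)"
    then have i: "i < d" using v by simp
    have "(\<mu> \<cdot>\<^sub>v v - B *\<^sub>v v) $ i = 0" using v Cv[OF v(1)] i by simp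
    then show "(B *\<^sub>v v) $ i = (\<mu> \<cdot>\<^sub>v v) $ i" using B v i by simp
  qed (use B v in simp)
  then have "eigenvalue B \<mu>"
    using B v by (auto simp: eigenvalue_def eigenvector_def)
  then show ?thesis using that bound by blast
qed

section \<open>Deviation of an eigenvalue from the spectral mean\<close>

text \<open>The centred matrix \<open>X\<close> has trace zero, so subtracting \<open>I / d\<close>
  from the projection onto \<open>v\<close> leaves its inner product with \<open>X\<close>
  unchanged, while the squared norm of the projection drops from 1 to \<open>1 - 1 / d\<close>. This
  gain turns a factor \<open>d\<close> into \<open>d - 1\<close>.\<close>

lemma eigenvalue_deviation_bound:
  fixes B :: "real Matrix.mat"
  assumes B: "B \<in> carrier_mat d d" and sym: "transpose_mat B = B" and d: "d \<ge> 1"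
    and ev: "eigenvalue B l"
  defines "m \<equiv> mat_trace B / real d"
  shows "(l - m)\<^sup>2 \<le> (real d - 1) * (mat_trace (B ^\<^sub>m 2) / real d - m\<^sup>2)"
proof -
  obtain v where v: "v \<in> carrier_vec d" "v \<noteq> 0\<^sub>v d" "B *\<^sub>v v = l \<cdot>\<^sub>v v"
    using ev B by (auto simp: eigenvalue_def eigenvector_def)
  define r where "r = v \<bullet> v"
  have r: "r > 0" using scalar_prod_self_pos v by (simp add: r_def)
  have r_sum: "(\<Sum>i<d. (v $ i)\<^sup>2) = r"
    using scalar_prod_self_eq_sum[OF v(1)] by (simp add: r_def)
  \<comment> \<open>The matrices are taken as functions of two indices, to fit Cauchy--Schwarz for
    finite sums. Dividing by \<open>r\<close> in \<open>Y\<close> replaces the normalization of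
    \<open>v\<close>.\<close>
  define I where "I = (\<lambda>i j :: nat. if i = j then 1 else 0 :: real)"
  define X where "X = (\<lambda>i j. B $$ (i, j) - m * I i j)"
  define Y where "Y = (\<lambda>i j. v $ i * v $ j / r - I i j / real d)"
  have tr: "mat_trace B = (\<Sum>i<d. B $$ (i, i))" using B by (simp add: mat_trace_def)
  have sym_entry: "B $$ (j, i) = B $$ (i, j)" if "i < d" "j < d" for i j
    using sym B that by (metis carrier_matD index_transpose_mat(1))
  have "mat_trace (B ^\<^sub>m 2) = mat_trace (B * B)"
    using B by (simp add: numeral_2_eq_2)
  also have "\<dots> = (\<Sum>i<d. \<Sum>j<d. B $$ (i, j) * B $$ (j, i))"
    using B by (auto simp: mat_trace_def scalar_prod_def lessThan_atLeast0 intro!: sum.cong)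
  finally have tr2: "mat_trace (B ^\<^sub>m 2) = (\<Sum>i<d. \<Sum>j<d. (B $$ (i, j))\<^sup>2)"
    using sym_entry by (auto simp: power2_eq_square intro!: sum.cong)
  \<comment> \<open>The three expansions below are arranged as a full double sum plus a multiple of
    \<open>I\<close>, so that this identity reduces the second part to a sum over the
    diagonal.\<close>
  have I_sum: "(\<Sum>i<d. \<Sum>j<d. f i j * I i j) = (\<Sum>i<d. f i i)" for f :: "nat \<Rightarrow> nat \<Rightarrow> real"
    by (auto simp: I_def if_distrib cong: if_cong intro!: sum.cong)
  have I_sq: "I i j * I i j = I i j" for i j by (simp add: I_def)
  have X_norm: "(\<Sum>i<d. \<Sum>j<d. (X i j)\<^sup>2) = mat_trace (B ^\<^sub>m 2) - real d * m\<^sup>2"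
  proof -
    have "(\<Sum>i<d. \<Sum>j<d. (X i j)\<^sup>2)
        = (\<Sum>i<d. \<Sum>j<d. (B $$ (i, j))\<^sup>2 + (m\<^sup>2 - 2 * m * B $$ (i, j)) * I i j)"
      by (intro sum.cong refl) (auto simp: X_def I_def power2_diff)
    also have "\<dots> = mat_trace (B ^\<^sub>m 2) + (real d * m\<^sup>2 - 2 * m * mat_trace B)"
      by (simp add: sum.distrib I_sum tr2 tr sum_subtractf sum_distrib_left)
    also have "mat_trace B = real d * m" using d by (simp add: m_def)
    finally show ?thesis by (simp add: power2_eq_square)
  qed
  have vv: "(\<Sum>i<d. \<Sum>j<d. (v $ i * v $ j)\<^sup>2) = r\<^sup>2"
    unfolding power_mult_distrib sum_product[symmetric] r_sum by (simp add: power2_eq_square)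
  have Y_norm: "(\<Sum>i<d. \<Sum>j<d. (Y i j)\<^sup>2) = 1 - 1 / real d"
  proof -
    have "(\<Sum>i<d. \<Sum>j<d. (Y i j)\<^sup>2)
        = (\<Sum>i<d. \<Sum>j<d. (v $ i * v $ j)\<^sup>2 / r\<^sup>2
            + (1 / (real d)\<^sup>2 - 2 / (r * real d) * (v $ i * v $ j)) * I i j)"
      by (intro sum.cong refl) (auto simp: Y_def I_def power2_diff power_divide)
    also have "\<dots> = (\<Sum>i<d. \<Sum>j<d. (v $ i * v $ j)\<^sup>2) / r\<^sup>2
        + (real d / (real d)\<^sup>2 - 2 / (r * real d) * (\<Sum>i<d. (v $ i)\<^sup>2))"
      by (simp add: sum.distrib I_sum sum_subtractf power2_eq_square
          flip: sum_distrib_left sum_divide_distrib)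
    finally show ?thesis unfolding vv r_sum
      using r d by (simp add: power2_eq_square)
  qed
  have XY: "(\<Sum>i<d. \<Sum>j<d. X i j * Y i j) = l - m"
  proof -
    have "(\<Sum>i<d. \<Sum>j<d. X i j * Y i j)
        = (\<Sum>i<d. \<Sum>j<d. v $ i * B $$ (i, j) * v $ j / r
            + (m / real d - B $$ (i, j) / real d - m / r * (v $ i * v $ j)) * I i j)"
      by (intro sum.cong refl) (auto simp: X_def Y_def I_def algebra_simps)
    \<comment> \<open>The terms \<open>m - mat_trace B / real d\<close> cancel by the definition of
      \<open>m\<close>: this is the trace of \<open>X\<close> being zero.\<close>
    also have "\<dots> = (\<Sum>i<d. \<Sum>j<d. v $ i * B $$ (i, j) * v $ j) / r
        + (m - mat_trace B / real d - m / r * (\<Sum>i<d. (v $ i)\<^sup>2))"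
      using d by (simp add: sum.distrib I_sum sum_subtractf power2_eq_square tr
          flip: sum_distrib_left sum_divide_distrib)
    also have "(\<Sum>i<d. \<Sum>j<d. v $ i * B $$ (i, j) * v $ j) = l * r"
      using bilinear_form_eq_sum[OF B v(1) v(1)] v by (simp add: r_def)
    finally show ?thesis unfolding r_sum
      using r by (simp add: m_def)
  qed
  \<comment> \<open>Cauchy--Schwarz is available for single sums, hence the passage to index
    pairs.\<close>
  have pairs: "(\<Sum>i<d. \<Sum>j<d. f i j) = (\<Sum>z\<in>{..<d} \<times> {..<d}. f (fst z) (snd z))"
    for f :: "nat \<Rightarrow> nat \<Rightarrow> real"
    by (simp add: sum.cartesian_product case_prod_unfold)
  have "(l - m)\<^sup>2 \<le> (mat_trace (B ^\<^sub>m 2) - real d * m\<^sup>2) * (1 - 1 / real d)"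
    unfolding XY[symmetric] X_norm[symmetric] Y_norm[symmetric] pairs
    by (rule Cauchy_Schwarz_ineq_sum)
  also have "\<dots> = (real d - 1) * (mat_trace (B ^\<^sub>m 2) / real d - m\<^sup>2)"
    using d by (simp add: field_simps)
  finally show ?thesis .
qed

section \<open>Power iterates and the largest T-eigenvalue\<close>

lemma unit_vec_of_carrier: "v \<in> carrier_vec d \<Longrightarrow> unit_vec_of v \<in> carrier_vec d"
  by (simp add: unit_vec_of_def)

text \<open>The quotient of \<open>v \<bullet> v\<close> by itself is 1, or 0 for the zero vector by
  the convention on division; the inequality covers both cases.\<close>

lemma unit_vec_of_norm_le: "unit_vec_of v \<bullet> unit_vec_of v \<le> 1"
proof -
  have "unit_vec_of v \<bullet> unit_vec_of v = (v \<bullet> v) / (vec_norm2 v)\<^sup>2"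
    by (simp add: unit_vec_of_def power2_eq_square)
  also have "(vec_norm2 v)\<^sup>2 = v \<bullet> v"
    by (simp add: vec_norm2_def scalar_prod_self_nonneg)
  finally show ?thesis by simp
qed

lemma power_iterate_carrier:
  assumes "B \<in> carrier_mat d d" "g \<in> carrier_vec d"
  shows "power_iterate B g k \<in> carrier_vec d"
  using assms by (induction k) (auto intro!: unit_vec_of_carrier)

lemma power_iterate_norm_le: "power_iterate B g k \<bullet> power_iterate B g k \<le> 1"
  by (cases k) (simp_all add: unit_vec_of_norm_le)

text \<open>Positivity of the eigenvalue is what turns \<open>x \<bullet> x \<le> 1\<close> into
  \<open>\<mu> * (x \<bullet> x) \<le> \<mu>\<close> for a power iterate \<open>x\<close>.\<close>

lemma eigenvalue_pos:
  fixes B :: "real Matrix.mat"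
  assumes "sym_pos_def B" "eigenvalue B l"
  shows "l > 0"
proof -
  obtain v where v: "v \<in> carrier_vec (dim_row B)" "v \<noteq> 0\<^sub>v (dim_row B)" "B *\<^sub>v v = l \<cdot>\<^sub>v v"
    using assms by (auto simp: eigenvalue_def eigenvector_def)
  then have "l * (v \<bullet> v) > 0" using assms(1) by (auto simp: sym_pos_def_def)
  then show ?thesis using scalar_prod_self_nonneg[of v] by (simp add: zero_less_mult_iff)
qed

text \<open>Any eigenvalue \<open>l\<close> witnesses that the sorted list is nonempty, so
  \<open>hd\<close> returns its maximum rather than an unspecified value.\<close>

lemma largest_T_eigenvalue_ge:
  assumes "eigenvalue (bcirc n p A) l"
  shows "l \<le> largest_T_eigenvalue n p A"
    and "eigenvalue (bcirc n p A) (largest_T_eigenvalue n p A)"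
proof -
  have mem: "l \<in> set (T_eigenvalues n p A)"
    using assms by (simp add: set_T_eigenvalues)
  then obtain e es where es: "T_eigenvalues n p A = e # es"
    by (cases "T_eigenvalues n p A") auto
  show "l \<le> largest_T_eigenvalue n p A"
    using mem sorted_T_eigenvalues[of n p A] by (auto simp: largest_T_eigenvalue_def es)
  have "e \<in> set (T_eigenvalues n p A)" by (simp add: es)
  then show "eigenvalue (bcirc n p A) (largest_T_eigenvalue n p A)"
    unfolding set_T_eigenvalues by (simp add: largest_T_eigenvalue_def es)
qed

theorem theorem5p1:
  fixes n p q :: nat
    and A :: "real Matrix.mat list"
    and M :: "'w measure"
    and g :: "'w \<Rightarrow> real Matrix.vec"
  assumes "n \<ge> 1" and "p \<ge> 1"
    and "A \<in> tensors n p"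
    and "T_SPD n p A"
    and "q \<ge> 1"
    and "prob_space M"
    and "std_gaussian_vec M (n * p) g"
  shows "(AE \<omega> in M. pow_estimate n p A q (g \<omega>) \<le> largest_T_eigenvalue n p A
             \<and> largest_T_eigenvalue n p A \<le> TDep_estimate n p A)
       \<and> (AE \<omega> in M. largest_T_eigenvalue n p A
             \<in> {pow_estimate n p A q (g \<omega>) .. TDep_estimate n p A})"
proof -
  define B where "B = bcirc n p A"
  define d where "d = n * p"
  define l where "l = largest_T_eigenvalue n p A"
  have B: "B \<in> carrier_mat d d" by (simp add: B_def d_def bcirc_carrier)
  have d: "d \<ge> 1" using assms(1,2) by (simp add: d_def)
  have spd: "sym_pos_def B" using assms(4) by (simp add: T_SPD_def B_def)
  then have sym: "transpose_mat B = B" by (simp add: sym_pos_def_def)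
  obtain \<mu> where \<mu>: "eigenvalue B \<mu>"
    and bound: "\<And>x. x \<in> carrier_vec d \<Longrightarrow> x \<bullet> (B *\<^sub>v x) \<le> \<mu> * (x \<bullet> x)"
    using rayleigh_bounded_by_eigenvalue[OF B sym d] by blast
  have l: "\<mu> \<le> l" "eigenvalue B l"
    using largest_T_eigenvalue_ge[of n p A \<mu>] \<mu> by (auto simp: B_def l_def)
  \<comment> \<open>The estimate is pointwise on the sample space; \<open>AE_I2\<close> makes it an
    almost sure one at the end.\<close>
  have lower: "pow_estimate n p A q (g \<omega>) \<le> l" if "\<omega> \<in> space M" for \<omega>
  proof -
    define x where "x = power_iterate B (g \<omega>) q"
    have "g \<omega> \<in> carrier_vec d"
      using assms(7) that by (simp add: std_gaussian_vec_def d_def)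
    then have "x \<in> carrier_vec d" unfolding x_def by (rule power_iterate_carrier[OF B])
    from bound[OF this] have "pow_estimate n p A q (g \<omega>) \<le> \<mu> * (x \<bullet> x)"
      by (simp add: pow_estimate_def x_def B_def Let_def)
    also have "\<dots> \<le> \<mu>"
      using eigenvalue_pos[OF spd \<mu>] power_iterate_norm_le[of B "g \<omega>" q]
      by (simp add: x_def mult_left_le)
    finally show ?thesis using l(1) by linarith
  qed
  \<comment> \<open>\<open>real_le_rsqrt\<close> asks for no sign of the left-hand side.\<close>
  have "l - spec_mean n p A
      \<le> sqrt ((real d - 1) * (mat_trace (B ^\<^sub>m 2) / real d - (spec_mean n p A)\<^sup>2))"
    using eigenvalue_deviation_bound[OF B sym d l(2)]
    by (intro real_le_rsqrt) (simp add: spec_mean_def B_def d_def)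
  \<comment> \<open>The root of the product splits into \<open>sqrt (real d - 1)\<close> and
    \<open>spec_std n p A\<close>; \<open>real_sqrt_mult\<close> holds for all reals, so the sign of
    the variance is not at issue.\<close>
  then have upper: "l \<le> TDep_estimate n p A"
    by (simp add: TDep_estimate_def spec_std_def real_sqrt_mult B_def d_def mult.commute)
  show ?thesis
    using lower upper by (auto simp: l_def intro!: AE_I2)
qed

end
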